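(* Let $r$ and $k$ be integers with $2\le k\le r+1$. Then the infinite $r$-graph $G_{r,k-1}$ is $H_k^r$-free, i.e., there is no set of $r+1$ points of $\mathbf{C}$ of which at least $k$ of its $r$-element subsets are edges of $G_{r,k-1}$.
   Context: Let $\mathbf{C}=\{z\in\mathbb{C}:|z|=1\}$ be the unit circle (arc lengths measured on it, total length $2\pi$). For a finite $A\subset\mathbf{C}$, let $\Pi(A)$ be the product of its elements and, for $t\le|A|$, let $\Delta_t(A)$ be the length of the shortest arc of $\mathbf{C}$ containing at least $t$ elements of $A$. For $1\le t\le r$, $G_{r,t}$ is the $r$-uniform hypergraph with vertex set $\mathbf{C}$ in which an $r$-element subset $A\subset\mathbf{C}$ is an edge iff $\Pi(A)=e^{i\varphi}$ for some $\varphi\in[0,\Delta_t(A)]$. $H_k^r$ is the $r$-graph with $r+1$ vertices and $k$ edges. *)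

theory Defs
  imports "HOL-Analysis.Analysis"
begin

type_synonym 'a hypergraph = "'a set \<times> 'a set set"

abbreviation verts :: "'a hypergraph \<Rightarrow> 'a set" where "verts G \<equiv> fst G"
abbreviation edges :: "'a hypergraph \<Rightarrow> 'a set set" where "edges G \<equiv> snd G"

definition r_graph :: "nat \<Rightarrow> 'a hypergraph \<Rightarrow> bool" where
  "r_graph r G \<longleftrightarrow> (\<forall>e\<in>edges G. e \<subseteq> verts G \<and> finite e \<and> card e = r)"

definition subhypergraph :: "'a hypergraph \<Rightarrow> 'a hypergraph \<Rightarrow> bool" where
  "subhypergraph H G \<longleftrightarrow> verts H \<subseteq> verts G \<and> edges H \<subseteq> edges G"

text \<open>For \<open>k \<le> r + 1\<close> there is exactly one \<open>r\<close>-graph with \<open>r + 1\<close> vertices and \<open>k\<close> edges up to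
  isomorphism, so being a copy of it is expressed by the two cardinalities.\<close>

definition is_H :: "nat \<Rightarrow> nat \<Rightarrow> 'a hypergraph \<Rightarrow> bool" where
  "is_H r k H \<longleftrightarrow> r_graph r H \<and> finite (verts H) \<and> card (verts H) = r + 1
     \<and> finite (edges H) \<and> card (edges H) = k"

text \<open>Freeness refers to subgraphs that need not be induced.\<close>

definition H_free :: "nat \<Rightarrow> nat \<Rightarrow> 'a hypergraph \<Rightarrow> bool" where
  "H_free r k G \<longleftrightarrow> \<not> (\<exists>H. subhypergraph H G \<and> is_H r k H)"

abbreviation unit_circle :: "complex set" where
  "unit_circle \<equiv> sphere 0 1"

text \<open>The closed arc running counterclockwise from \<open>cis a\<close>; its length is \<open>l\<close> provided
  \<open>0 \<le> l \<le> 2 * pi\<close>. For \<open>l = 0\<close> it is a single point, for \<open>l = 2 * pi\<close> the whole circle.\<close>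

definition circle_arc :: "real \<Rightarrow> real \<Rightarrow> complex set" where
  "circle_arc a l = cis ` {a..a + l}"

text \<open>For finite \<open>A \<subseteq> unit_circle\<close> and \<open>t \<le> card A\<close>, the set of lengths is nonempty and the infimum
  is attained, because the arcs are closed: it is the length of a shortest arc.\<close>

definition arc_Delta :: "nat \<Rightarrow> complex set \<Rightarrow> real" where
  "arc_Delta t A = Inf {l. 0 \<le> l \<and> l \<le> 2 * pi \<and> (\<exists>a. t \<le> card (A \<inter> circle_arc a l))}"

definition G_graph :: "nat \<Rightarrow> nat \<Rightarrow> complex hypergraph" where
  "G_graph r t = (unit_circle,
     {A. A \<subseteq> unit_circle \<and> finite A \<and> card A = r \<and>
         (\<exists>\<phi>\<in>{0..arc_Delta t A}. \<Prod>A = exp (\<i> * complex_of_real \<phi>))})"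

end

theory Submission
  imports Defs
begin

text \<open>Let \<open>P\<close> be the product of an \<open>(r + 1)\<close>-set \<open>S\<close>. If \<open>S - {v}\<close> is an edge with angle \<open>\<phi> v\<close>, then
  \<open>v = P * cis (- \<phi> v)\<close>, so distinct such \<open>v\<close> have distinct angles. Take \<open>m\<close> with the largest
  angle and let \<open>s < \<phi> m\<close> be the second largest one. Then the arc of length \<open>s\<close> ending at \<open>P\<close> contains
  all the other \<open>v\<close>, hence \<open>\<phi> m \<le> arc_Delta (k - 1) (S - {m}) \<le> s\<close> if there are at least \<open>k\<close> such \<open>v\<close>.\<close>

lemma arc_Delta_le:
  assumes "0 \<le> l" "l \<le> 2 * pi" "t \<le> card (A \<inter> circle_arc a l)"
  shows "arc_Delta t A \<le> l"
  unfolding arc_Delta_def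
proof (rule cInf_lower)
  show "bdd_below {l. 0 \<le> l \<and> l \<le> 2 * pi \<and> (\<exists>a. t \<le> card (A \<inter> circle_arc a l))}"
    by (rule bdd_belowI[of _ 0]) auto
qed (use assms in blast)

lemma circle_arc_full: "circle_arc 0 (2 * pi) = unit_circle"
proof -
  have "z \<in> cis ` {0..2 * pi}" if "norm z = 1" for z
  proof -
    obtain t where "0 \<le> t" "t < 2 * pi" "z = cis t"
      using complex_unimodular_polar[OF \<open>norm z = 1\<close>] by (auto simp: complex_eq_iff)
    then show ?thesis by auto
  qed
  then show ?thesis by (auto simp: circle_arc_def)
qed

text \<open>The whole circle is itself an admissible arc. This bound keeps every edge angle at most
  \<open>2 * pi\<close>, so that such angles can serve as arc lengths in
  \<open>arc_Delta_le\<close>.\<close>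

lemma arc_Delta_le_2pi:
  assumes "A \<subseteq> unit_circle" "t \<le> card A"
  shows "arc_Delta t A \<le> 2 * pi"
proof (rule arc_Delta_le)
  show "t \<le> card (A \<inter> circle_arc 0 (2 * pi))"
    using assms by (simp add: circle_arc_full Int_absorb2)
qed simp_all

lemma card_removable_less:
  assumes S: "S \<subseteq> unit_circle" "finite S" "card S = r + 1"
    and k: "2 \<le> k" "k \<le> r + 1"
  shows "card {v \<in> S. S - {v} \<in> edges (G_graph r (k - 1))} < k"
proof (rule ccontr)
  define V where "V = {v \<in> S. S - {v} \<in> edges (G_graph r (k - 1))}"
  assume "\<not> ?thesis"
  then have kV: "k \<le> card V" by (simp add: V_def)
  have VS: "V \<subseteq> S" and finV: "finite V" using S(2) by (auto simp: V_def)
  obtain \<theta> where \<theta>: "\<Prod>S = cis \<theta>"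
  proof -
    have "norm (\<Prod>S) = (\<Prod>z\<in>S. norm z)" by (simp add: prod_norm)
    also have "\<dots> = 1" using S(1) by (intro prod.neutral) auto
    finally have "\<Prod>S \<in> circle_arc 0 (2 * pi)" by (simp add: circle_arc_full)
    then show thesis using that by (auto simp: circle_arc_def)
  qed
  have "\<forall>v\<in>V. \<exists>\<phi>\<in>{0..arc_Delta (k - 1) (S - {v})}. \<Prod>(S - {v}) = exp (\<i> * complex_of_real \<phi>)"
    by (auto simp: V_def G_graph_def)
  then obtain \<phi> where \<phi>: "\<And>v. v \<in> V \<Longrightarrow> \<phi> v \<in> {0..arc_Delta (k - 1) (S - {v})}"
    and prod: "\<And>v. v \<in> V \<Longrightarrow> \<Prod>(S - {v}) = exp (\<i> * complex_of_real (\<phi> v))"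
    by metis
  have v_eq: "v = cis (\<theta> - \<phi> v)" if "v \<in> V" for v
  proof -
    have "cis \<theta> = v * \<Prod>(S - {v})"
      using that VS S(2) \<theta> prod.remove[of S v "\<lambda>z. z"] by auto
    also have "\<dots> = v * cis (\<phi> v)" by (simp add: prod[OF that] cis_conv_exp)
    finally have "v = cis \<theta> / cis (\<phi> v)" by simp
    then show ?thesis by (simp only: cis_divide)
  qed
  \<comment> \<open>By \<open>v_eq\<close>, the angle \<open>\<phi> v\<close> determines the point
    \<open>v\<close>.\<close>
  have inj: "inj_on \<phi> V" by (rule inj_onI) (metis v_eq)
  have "V \<noteq> {}" using kV k by auto
  then have "Max (\<phi> ` V) \<in> \<phi> ` V" using finV by simp
  then obtain m where m: "m \<in> V" and m_max: "\<phi> m = Max (\<phi> ` V)" by auto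
  define s where "s = Max (\<phi> ` (V - {m}))"
  have cardW: "card (V - {m}) = card V - 1" using m by (rule card_Diff_singleton)
  \<comment> \<open>Since \<open>2 \<le> k\<close>, a point other than \<open>m\<close> remains, so
    the maximum defining \<open>s\<close> is attained.\<close>
  then have "V - {m} \<noteq> {}" using kV k by force
  then have "s \<in> \<phi> ` (V - {m})" unfolding s_def using finV by (intro Max_in) auto
  then obtain w where w: "w \<in> V" "w \<noteq> m" "s = \<phi> w" by auto
  have "\<phi> w \<le> \<phi> m" using w finV by (simp add: m_max)
  \<comment> \<open>Injectivity makes the inequality strict; the closing bound
    \<open>\<phi> m \<le> s\<close> would not contradict a tie.\<close>
  moreover have "\<phi> w \<noteq> \<phi> m" using inj w m by (auto dest: inj_onD)
  ultimately have "s < \<phi> m" using w by simp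
  \<comment> \<open>As \<open>k - 1 \<le> r\<close>, the set \<open>S - {m}\<close> has enough
    points for the whole circle to qualify, whence \<open>s < \<phi> m \<le> 2 * pi\<close>.\<close>
  have "card (S - {m}) = r" using m VS S by auto
  then have "arc_Delta (k - 1) (S - {m}) \<le> 2 * pi"
    using S(1) k by (intro arc_Delta_le_2pi) auto
  then have "s \<le> 2 * pi" using \<open>s < \<phi> m\<close> \<phi>[OF m] by auto
  \<comment> \<open>Angles \<open>\<phi> v\<close> between \<open>0\<close> and \<open>s\<close>
    place \<open>cis (\<theta> - \<phi> v)\<close> on the arc running from
    \<open>\<theta> - s\<close> up to \<open>\<theta>\<close>.\<close>
  have "V - {m} \<subseteq> (S - {m}) \<inter> circle_arc (\<theta> - s) s"
  proof
    fix v assume v: "v \<in> V - {m}"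
    then have "\<phi> v \<le> s" unfolding s_def using finV by (intro Max_ge) auto
    moreover have "0 \<le> \<phi> v" using \<phi> v by auto
    ultimately have "cis (\<theta> - \<phi> v) \<in> circle_arc (\<theta> - s) s" by (simp add: circle_arc_def)
    then have "v \<in> circle_arc (\<theta> - s) s" using v v_eq by (metis DiffD1)
    then show "v \<in> (S - {m}) \<inter> circle_arc (\<theta> - s) s" using v VS by blast
  qed
  then have "card (V - {m}) \<le> card ((S - {m}) \<inter> circle_arc (\<theta> - s) s)"
    using S(2) by (intro card_mono) auto
  \<comment> \<open>Only \<open>m\<close> is lost from the at least \<open>k\<close> points of
    \<open>V\<close>, which is why the graph is taken with parameter \<open>k - 1\<close>.\<close>
  then have "k - 1 \<le> card ((S - {m}) \<inter> circle_arc (\<theta> - s) s)" using kV cardW by linarith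
  moreover have "0 \<le> s" using \<phi>[OF w(1)] w(3) by auto
  ultimately have "arc_Delta (k - 1) (S - {m}) \<le> s"
    using \<open>s \<le> 2 * pi\<close> by (intro arc_Delta_le)
  then show False using \<open>s < \<phi> m\<close> \<phi>[OF m] by auto
qed

text \<open>Each \<open>r\<close>-subset of \<open>S\<close> omits exactly one point, so edges
  inside \<open>S\<close> can be counted by their omitted points.\<close>

lemma card_edges_within_less:
  assumes S: "S \<subseteq> unit_circle" "finite S" "card S = r + 1"
    and k: "2 \<le> k" "k \<le> r + 1"
  shows "card {A. A \<subseteq> S \<and> card A = r \<and> A \<in> edges (G_graph r (k - 1))} < k"
proof -
  let ?V = "{v \<in> S. S - {v} \<in> edges (G_graph r (k - 1))}"
  have "{A. A \<subseteq> S \<and> card A = r \<and> A \<in> edges (G_graph r (k - 1))} \<subseteq> (\<lambda>v. S - {v}) ` ?V"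
  proof
    fix A assume A: "A \<in> {A. A \<subseteq> S \<and> card A = r \<and> A \<in> edges (G_graph r (k - 1))}"
    then have "card (S - A) = 1" using S finite_subset[of A S] by (simp add: card_Diff_subset)
    then obtain v where "S - A = {v}" by (auto simp: card_1_singleton_iff)
    then have "v \<in> S" "A = S - {v}" using A by auto
    then show "A \<in> (\<lambda>v. S - {v}) ` ?V" using A by auto
  qed
  then have "card {A. A \<subseteq> S \<and> card A = r \<and> A \<in> edges (G_graph r (k - 1))} \<le> card ?V"
    using S(2) by (intro surj_card_le) auto
  also have "\<dots> < k" using assms by (rule card_removable_less)
  finally show ?thesis .
qed

theorem theorem5:
  fixes r k :: nat
  assumes "2 \<le> k" and "k \<le> r + 1"
  shows "H_free r k (G_graph r (k - 1)) \<and>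
    \<not> (\<exists>S. S \<subseteq> unit_circle \<and> finite S \<and> card S = r + 1 \<and>
           k \<le> card {A. A \<subseteq> S \<and> card A = r \<and> A \<in> edges (G_graph r (k - 1))})"
proof
  show "H_free r k (G_graph r (k - 1))"
    unfolding H_free_def
  proof
    assume "\<exists>H. subhypergraph H (G_graph r (k - 1)) \<and> is_H r k H"
    then obtain H where H: "subhypergraph H (G_graph r (k - 1))" "is_H r k H" by blast
    let ?S = "verts H"
    let ?E = "{A. A \<subseteq> ?S \<and> card A = r \<and> A \<in> edges (G_graph r (k - 1))}"
    have S: "?S \<subseteq> unit_circle" "finite ?S" "card ?S = r + 1"
      using H by (auto simp: subhypergraph_def is_H_def G_graph_def)
    \<comment> \<open>A copy need not be induced, so only an inclusion holds; it suffices for the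
      count.\<close>
    have "edges H \<subseteq> ?E" using H by (auto simp: subhypergraph_def is_H_def r_graph_def)
    moreover have "finite ?E" by (rule finite_subset[of _ "Pow ?S"]) (use S in auto)
    ultimately have "card (edges H) \<le> card ?E" by (intro card_mono)
    then show False using card_edges_within_less[OF S assms] H(2) by (simp add: is_H_def)
  qed
  show "\<not> (\<exists>S. S \<subseteq> unit_circle \<and> finite S \<and> card S = r + 1 \<and>
           k \<le> card {A. A \<subseteq> S \<and> card A = r \<and> A \<in> edges (G_graph r (k - 1))})"
    using card_edges_within_less[OF _ _ _ assms] by (blast dest: leD)
qed

end
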